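(* Let $\alpha,\beta>0$ and $r$ be fixed, and let $S(\gamma,\eta;\epsilon)=S(\gamma,\eta,\alpha,\beta,r;\epsilon)$ be the generalized Stirling functions. The following hold, provided that the generalized Stirling functions appearing in the respective identity are defined (all terms of their defining series are defined and the series converge absolutely). (a) For $\gamma\in\mathbb{C}$, $\eta\in\mathbb{C}\setminus\mathbb{Z}$ and $\epsilon>0$, $$S(\gamma,\eta;\epsilon)=(r+\eta\beta-(\gamma-1)\alpha)\,S(\gamma-1,\eta;\epsilon)+S(\gamma-1,\eta-1;\epsilon).$$ (b) For $\gamma\in\mathbb{C}$, $\eta\in\mathbb{C}\setminus\mathbb{Z}$ with $\operatorname{Re}(\eta)>\operatorname{Re}(\gamma)$, the functions $S(\gamma,\eta):=S(\gamma,\eta;0)$ satisfy $$S(\gamma,\eta)=(r+\eta\beta-(\gamma-1)\alpha)\,S(\gamma-1,\eta)+S(\gamma-1,\eta-1).$$ (c) For $\gamma\in\mathbb{C}$, $k\in\mathbb{N}$ and $\epsilon\ge0$, $$S(\gamma,k;\epsilon)=(r+k\beta-(\gamma-1)\alpha)\,S(\gamma-1,k;\epsilon)+S(\gamma-1,k-1;\epsilon);$$ in particular, writing $S(\gamma,k):=S(\gamma,k;0)$, $S(\gamma,k)=(r+k\beta-(\gamma-1)\alpha)\,S(\gamma-1,k)+S(\gamma-1,k-1)$.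
   Context: For $\alpha>0$ and complex $z,\gamma$, the generalized falling factorial function is $\langle z\rangle_{\gamma,-\alpha}:=\alpha^{\gamma}\,\Gamma(z/\alpha+1)/\Gamma(z/\alpha-\gamma+1)$ (a factor $1/\Gamma$ at a pole of $\Gamma$ is read as $0$; $\Gamma(z/\alpha+1)$ must be finite); when $\gamma=n\in\mathbb{N}_0$ it is the polynomial $z(z-\alpha)\cdots(z-(n-1)\alpha)$ (equal to $1$ for $n=0$) and is defined for all $z$. General binomial coefficients are $\binom{\eta}{j}=\eta(\eta-1)\cdots(\eta-j+1)/j!$. For $\gamma,\eta\in\mathbb{C}$ and $\epsilon\ge0$ the generalized Stirling functions are $$S(\gamma,\eta;\epsilon)=S(\gamma,\eta,\alpha,\beta,r;\epsilon):=\frac{1}{\beta^{\eta}\,\Gamma(\eta+1)}\sum_{j\ge0}(-1)^j\binom{\eta}{j}e^{(\eta-j)\epsilon}\,\langle r+(\eta-j)\beta\rangle_{\gamma,-\alpha}\qquad(\gamma\neq0),$$ provided the series converges absolutely, and $S(0,\eta;\epsilon):=\dfrac{(e^{\epsilon}-1)^{\eta}}{\beta^{\eta}\,\Gamma(\eta+1)}$, where $0^0=1$ and $0^\eta=0$ for $\operatorname{Re}\eta>0$. *)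

theory Defs
  imports "HOL-Analysis.Analysis"
begin

text \<open>
  The generalized falling factorial \<open>\<langle>z\<rangle>\<close> with subscripts \<open>\<gamma>, -\<alpha>\<close>. If \<open>\<gamma>\<close> is a natural number \<open>n\<close>,
  it is the polynomial \<open>z (z - \<alpha>) \<dots> (z - (n - 1) \<alpha>)\<close>, for every \<open>z\<close>; here \<open>n\<close> is recovered from
  the complex number \<open>\<gamma>\<close> as \<open>nat \<lfloor>Re \<gamma>\<rfloor>\<close>. The entire function \<open>rGamma\<close> implements the convention
  that \<open>1/\<Gamma>\<close> is \<open>0\<close> at a pole of \<open>\<Gamma>\<close>. At a pole of the numerator \<open>Gamma\<close> has the dummy value \<open>0\<close>;
  such points are excluded by \<open>gen_ffact_defined\<close>.
\<close>

definition gen_ffact :: "real \<Rightarrow> complex \<Rightarrow> complex \<Rightarrow> complex" where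
  "gen_ffact \<alpha> \<gamma> z =
     (if \<gamma> \<in> \<nat> then (\<Prod>i<nat \<lfloor>Re \<gamma>\<rfloor>. z - of_nat i * of_real \<alpha>)
      else of_real \<alpha> powr \<gamma> * Gamma (z / of_real \<alpha> + 1) * rGamma (z / of_real \<alpha> - \<gamma> + 1))"

definition gen_ffact_defined :: "real \<Rightarrow> complex \<Rightarrow> complex \<Rightarrow> bool" where
  "gen_ffact_defined \<alpha> \<gamma> z \<longleftrightarrow> \<gamma> \<in> \<nat> \<or> z / of_real \<alpha> + 1 \<notin> \<int>\<^sub>\<le>\<^sub>0"

definition gen_stirling_term ::
    "real \<Rightarrow> real \<Rightarrow> complex \<Rightarrow> complex \<Rightarrow> complex \<Rightarrow> real \<Rightarrow> nat \<Rightarrow> complex" where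
  "gen_stirling_term \<alpha> \<beta> r \<gamma> \<eta> \<epsilon> j =
     (-1) ^ j * (\<eta> gchoose j) * exp ((\<eta> - of_nat j) * of_real \<epsilon>)
       * gen_ffact \<alpha> \<gamma> (r + (\<eta> - of_nat j) * of_real \<beta>)"

text \<open>
  In the case \<open>\<gamma> = 0\<close>, the library's \<open>0 powr \<eta>\<close> is \<open>0\<close> for every \<open>\<eta>\<close>, including \<open>\<eta> = 0\<close>, so the
  convention \<open>0\<^sup>0 = 1\<close> needs its own branch.
\<close>

definition gen_stirling ::
    "real \<Rightarrow> real \<Rightarrow> complex \<Rightarrow> complex \<Rightarrow> complex \<Rightarrow> real \<Rightarrow> complex" where
  "gen_stirling \<alpha> \<beta> r \<gamma> \<eta> \<epsilon> =
     (if \<gamma> = 0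
      then (if \<epsilon> = 0 \<and> \<eta> = 0 then 1 else of_real (exp \<epsilon> - 1) powr \<eta>)
             * rGamma (\<eta> + 1) / of_real \<beta> powr \<eta>
      else rGamma (\<eta> + 1) / of_real \<beta> powr \<eta> * (\<Sum>j. gen_stirling_term \<alpha> \<beta> r \<gamma> \<eta> \<epsilon> j))"

text \<open>
  For \<open>\<gamma> = 0\<close> the function is defined unless \<open>\<epsilon> = 0\<close> and \<open>0 powr \<eta>\<close> carries no meaning, i.e. unless
  \<open>\<eta> \<noteq> 0\<close> and \<open>Re \<eta> \<le> 0\<close>. For \<open>\<gamma> \<noteq> 0\<close>, a term with vanishing binomial coefficient is \<open>0\<close> and imposes
  no condition: when \<open>\<eta> = k\<close> is a natural number the series is the finite sum over \<open>j \<le> k\<close>.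
\<close>

definition gen_stirling_defined ::
    "real \<Rightarrow> real \<Rightarrow> complex \<Rightarrow> complex \<Rightarrow> complex \<Rightarrow> real \<Rightarrow> bool" where
  "gen_stirling_defined \<alpha> \<beta> r \<gamma> \<eta> \<epsilon> \<longleftrightarrow>
     (if \<gamma> = 0 then \<epsilon> > 0 \<or> \<epsilon> = 0 \<and> (\<eta> = 0 \<or> Re \<eta> > 0)
      else (\<forall>j. \<eta> gchoose j \<noteq> 0 \<longrightarrow> gen_ffact_defined \<alpha> \<gamma> (r + (\<eta> - of_nat j) * of_real \<beta>))
           \<and> summable (\<lambda>j. norm (gen_stirling_term \<alpha> \<beta> r \<gamma> \<eta> \<epsilon> j)))"

end

theory Submission
  imports Defs "HOL-Real_Asymp.Real_Asymp"
begin

text \<open>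
  Every part is the same computation on the defining series. With \<open>z\<^sub>j = r + (\<eta> - j) \<beta>\<close>, the falling
  factorial satisfies \<open>\<langle>z\<^sub>j\<rangle>\<^sub>\<gamma> = (z\<^sub>j - (\<gamma> - 1) \<alpha>) \<langle>z\<^sub>j\<rangle>\<^sub>\<gamma>\<^sub>-\<^sub>1\<close>, by the functional equation of the Gamma function
  (\<open>gen_ffact_recurrence\<close>). The factor splits as \<open>(r + \<eta> \<beta> - (\<gamma> - 1) \<alpha>) - j \<beta>\<close>. Its first part does not
  depend on \<open>j\<close>; in the second, absorption \<open>j (\<eta> choose j) = \<eta> (\<eta> - 1 choose j - 1)\<close> together with
  \<open>\<eta> - j = (\<eta> - 1) - (j - 1)\<close> produces the series of \<open>S(\<gamma> - 1, \<eta> - 1; \<epsilon>)\<close>, shifted by one place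
  (\<open>gen_stirling_term_recurrence\<close>). The prefactors match because \<open>\<eta> / \<Gamma>(\<eta> + 1) = 1 / \<Gamma>(\<eta>)\<close> and
  \<open>\<beta> / \<beta>\<^sup>\<eta> = 1 / \<beta>\<^sup>\<eta>\<^sup>-\<^sup>1\<close>.

  This argument needs \<open>S(\<gamma>, \<eta>; \<epsilon>)\<close> to be its series for all three functions involved. If one of the
  first arguments is \<open>0\<close>, that function is given by the closed form \<open>(e\<^sup>\<epsilon> - 1)\<^sup>\<eta>\<close> instead, and the
  binomial theorem has to show that the series still represents it (\<open>gen_stirling_sums\<close>). For
  \<open>\<epsilon> > 0\<close> this is the binomial series at a point inside the disc of convergence. For \<open>\<epsilon> = 0\<close> it is a
  boundary point, where the partial sums are \<open>\<plusminus>(\<eta> - 1 choose n)\<close> and tend to \<open>0\<close> when \<open>Re \<eta> > 0\<close>.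

  A natural number \<open>\<eta> = k\<close> fits the same scheme: the binomial coefficients vanish for \<open>j > k\<close>, and the
  series is a finite sum.
\<close>

section \<open>Recurrence of the falling factorial\<close>

text \<open>
  Away from \<open>\<gamma> = 0\<close> the two factorials are of the same kind, both polynomials or both Gamma quotients
  with a common factor \<open>\<Gamma>(z / \<alpha> + 1)\<close>. At \<open>\<gamma> = 0\<close> the empty product on the left meets a Gamma quotient
  on the right; the identity becomes \<open>1 = (z + \<alpha>) \<langle>z\<rangle>\<^sub>-\<^sub>1\<close>, which fails at the poles of
  \<open>\<Gamma>(z / \<alpha> + 1)\<close>, and this is what the second hypothesis excludes.
\<close>

lemma gen_ffact_recurrence:
  assumes \<alpha>: "\<alpha> > 0" and def: "\<gamma> = 0 \<Longrightarrow> gen_ffact_defined \<alpha> (\<gamma> - 1) z"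
  shows "gen_ffact \<alpha> \<gamma> z = (z - (\<gamma> - 1) * of_real \<alpha>) * gen_ffact \<alpha> (\<gamma> - 1) z"
proof (cases "\<gamma> \<in> \<nat>")
  case True
  then obtain n where n: "\<gamma> = of_nat n"
    by (auto elim: Nats_cases)
  show ?thesis
  proof (cases n)
    case (Suc m)
    have "\<gamma> - 1 = of_nat m"
      by (simp add: n Suc)
    moreover have "nat \<lfloor>Re \<gamma>\<rfloor> = Suc m"
      by (simp add: n Suc)
    ultimately show ?thesis
      using True by (simp add: gen_ffact_def mult.commute)
  next
    case 0
    define w where "w = z / of_real \<alpha>"
    have z: "z = w * of_real \<alpha>"
      using \<alpha> by (simp add: w_def)
    have neg: "(-1 :: complex) \<notin> \<nat>"
      by (auto elim!: Nats_cases simp: complex_eq_iff)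
    have pole: "w + 1 \<notin> \<int>\<^sub>\<le>\<^sub>0"
      using def neg by (simp add: n 0 gen_ffact_defined_def w_def)
    have "Gamma (w + 1) * rGamma (w + 1) = 1"
      using pole by (simp add: rGamma_inverse_Gamma Gamma_eq_zero_iff)
    then have "Gamma (w + 1) * rGamma (w + 1 + 1) * (w + 1) = 1"
      by (simp only: rGamma_plus1[of "w + 1", symmetric] mult_ac)
    moreover have "complex_of_real \<alpha> powr (-1) = inverse (of_real \<alpha>)"
      using \<alpha> by (simp add: powr_minus)
    moreover have "z + of_real \<alpha> = of_real \<alpha> * (w + 1)"
      by (simp add: z algebra_simps)
    ultimately have "gen_ffact \<alpha> (\<gamma> - 1) z * (z + of_real \<alpha>) = 1"
      using \<alpha> neg by (simp add: gen_ffact_def n 0 w_def[symmetric] add.commute mult_ac)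
    then show ?thesis
      by (simp add: gen_ffact_def n 0 mult.commute)
  qed
next
  case False
  then have False': "\<gamma> - 1 \<notin> \<nat>"
    by (metis Nats_1 Nats_add diff_add_cancel)
  define w where "w = z / of_real \<alpha>"
  have z: "z = w * of_real \<alpha>"
    using \<alpha> by (simp add: w_def)
  have "rGamma (w - \<gamma> + 1) = (w - \<gamma> + 1) * rGamma (w - (\<gamma> - 1) + 1)"
    using rGamma_plus1[of "w - \<gamma> + 1"] by (simp add: algebra_simps)
  moreover have "complex_of_real \<alpha> powr \<gamma> = of_real \<alpha> * of_real \<alpha> powr (\<gamma> - 1)"
    using \<alpha> by (simp add: powr_diff)
  moreover have "z - (\<gamma> - 1) * of_real \<alpha> = of_real \<alpha> * (w - \<gamma> + 1)"
    by (simp add: z algebra_simps)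
  ultimately show ?thesis
    using False False' by (simp only: gen_ffact_def w_def[symmetric] if_False mult_ac)
qed

section \<open>The closed form as a series\<close>

text \<open>
  The coefficient \<open>z gchoose n\<close> has absolute value of order at most \<open>n\<close> to the power \<open>- Re z - 1\<close>.
\<close>

lemma gbinomial_tendsto_0:
  fixes z :: complex
  assumes "Re z > -1"
  shows "(\<lambda>n. z gchoose n) \<longlonglongrightarrow> 0"
proof -
  define d where "d n = (-1) ^ n / exp ((z + 1) * of_real (ln (real n)))" for n
  define c where "c = Re z + 1"
  have "c > 0"
    using assms by (simp add: c_def)
  then have "(\<lambda>n. exp (- (c * ln (real n)))) \<longlonglongrightarrow> 0"
    by real_asymp
  moreover have "norm (d n) = exp (- (c * ln (real n)))" for n
    by (simp add: c_def d_def norm_divide norm_mult norm_inverse norm_power exp_minus inverse_eq_divide)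
  ultimately have "d \<longlonglongrightarrow> 0"
    by (simp add: tendsto_norm_zero_iff[of d, symmetric])
  with gbinomial_asymptotic[of z]
  have "(\<lambda>n. (z gchoose n) / d n * d n) \<longlonglongrightarrow> inverse (Gamma (- z)) * 0"
    unfolding d_def by (rule tendsto_mult)
  moreover have "d n \<noteq> 0" for n
    by (simp add: d_def)
  ultimately show ?thesis
    by simp
qed

text \<open>
  The binomial series of \<open>(1 + x)\<^sup>\<eta>\<close> at the boundary point \<open>x = -1\<close>; its partial sums have a closed form,
  up to sign the binomial coefficient \<open>(\<eta> - 1) gchoose n\<close>.
\<close>

lemma alternating_gbinomial_sums_0:
  fixes \<eta> :: complex
  assumes "Re \<eta> > 0"
  shows "(\<lambda>j. (-1) ^ j * (\<eta> gchoose j)) sums 0"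
proof -
  have "(\<lambda>n. (\<eta> - 1) gchoose n) \<longlonglongrightarrow> 0"
    using assms by (intro gbinomial_tendsto_0) simp
  then have "(\<lambda>n. norm ((-1) ^ n * ((\<eta> - 1) gchoose n))) \<longlonglongrightarrow> 0"
    by (simp add: norm_mult norm_power tendsto_norm_zero)
  then have "(\<lambda>n. (-1) ^ n * ((\<eta> - 1) gchoose n)) \<longlonglongrightarrow> 0"
    by (rule tendsto_norm_zero_cancel)
  then have "(\<lambda>n. \<Sum>j\<le>n. (\<eta> gchoose j) * (-1) ^ j) \<longlonglongrightarrow> 0"
    by (simp add: gbinomial_sum_lower_neg)
  then show ?thesis
    by (simp add: sums_def_le mult.commute)
qed

lemma gen_stirling_term_0_sums:
  assumes "gen_stirling_defined \<alpha> \<beta> r 0 \<eta> \<epsilon>"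
  shows "gen_stirling_term \<alpha> \<beta> r 0 \<eta> \<epsilon> sums
           (if \<epsilon> = 0 \<and> \<eta> = 0 then 1 else of_real (exp \<epsilon> - 1) powr \<eta>)"
proof -
  have eq: "gen_stirling_term \<alpha> \<beta> r 0 \<eta> \<epsilon> =
      (\<lambda>j. (-1) ^ j * (\<eta> gchoose j) * exp ((\<eta> - of_nat j) * of_real \<epsilon>))"
    by (simp add: gen_stirling_term_def gen_ffact_def fun_eq_iff)
  consider "\<epsilon> > 0" | "\<epsilon> = 0" "\<eta> = 0" | "\<epsilon> = 0" "Re \<eta> > 0"
    using assms by (auto simp: gen_stirling_defined_def)
  then show ?thesis
  proof cases
    case 1
    have "exp ((\<eta> - of_nat j) * of_real \<epsilon>) = of_real (exp \<epsilon>) powr (\<eta> - of_nat j)" for j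
      by (simp add: powr_def Ln_of_real)
    moreover have "(\<lambda>j. (\<eta> gchoose j) * of_real (-1) ^ j * of_real (exp \<epsilon>) powr (\<eta> - of_nat j))
        sums of_real (-1 + exp \<epsilon>) powr \<eta>"
      using 1 by (intro gen_binomial_complex') simp
    ultimately show ?thesis
      using 1 by (simp add: eq mult_ac)
  next
    case 2
    then have "gen_stirling_term \<alpha> \<beta> r 0 \<eta> \<epsilon> = (\<lambda>j. if j = 0 then 1 else 0)"
      unfolding eq by (auto simp: fun_eq_iff gbinomial_0_left)
    moreover have "(\<lambda>j. if j = 0 then 1 else 0 :: complex) sums 1"
      using sums_single[of 0 "\<lambda>_. 1 :: complex"] by simp
    ultimately show ?thesis
      using 2 by simp
  next
    case 3
    then show ?thesis
      unfolding eq using alternating_gbinomial_sums_0[of \<eta>] by auto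
  qed
qed

text \<open>
  This uniform description removes the special role of \<open>\<gamma> = 0\<close> in the definition.
\<close>

lemma gen_stirling_sums:
  assumes "gen_stirling_defined \<alpha> \<beta> r \<gamma> \<eta> \<epsilon>"
  obtains s where "gen_stirling_term \<alpha> \<beta> r \<gamma> \<eta> \<epsilon> sums s"
    and "gen_stirling \<alpha> \<beta> r \<gamma> \<eta> \<epsilon> = rGamma (\<eta> + 1) / of_real \<beta> powr \<eta> * s"
proof (cases "\<gamma> = 0")
  case True
  then show thesis
    using that gen_stirling_term_0_sums[of \<alpha> \<beta> r \<eta> \<epsilon>] assms
    by (auto simp: gen_stirling_def split: if_splits)
next
  case False
  then have "summable (gen_stirling_term \<alpha> \<beta> r \<gamma> \<eta> \<epsilon>)"
    using assms by (auto simp: gen_stirling_defined_def intro: summable_norm_cancel)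
  then show thesis
    using that[OF summable_sums] False by (simp add: gen_stirling_def)
qed

section \<open>Recurrence of the Stirling functions\<close>

text \<open>
  The \<open>j\<close>-th terms of the three series, the last one shifted by one place. A term with vanishing
  binomial coefficient carries no information on its falling factorial, so it is treated apart.
\<close>

lemma gen_stirling_term_recurrence:
  assumes \<alpha>: "\<alpha> > 0" and def: "gen_stirling_defined \<alpha> \<beta> r (\<gamma> - 1) \<eta> \<epsilon>"
  shows "gen_stirling_term \<alpha> \<beta> r \<gamma> \<eta> \<epsilon> j =
           (r + \<eta> * of_real \<beta> - (\<gamma> - 1) * of_real \<alpha>) * gen_stirling_term \<alpha> \<beta> r (\<gamma> - 1) \<eta> \<epsilon> j
           + \<eta> * of_real \<beta> *
             (case j of 0 \<Rightarrow> 0 | Suc i \<Rightarrow> gen_stirling_term \<alpha> \<beta> r (\<gamma> - 1) (\<eta> - 1) \<epsilon> i)"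
proof -
  define z where "z = r + (\<eta> - of_nat j) * of_real \<beta>"
  define E where "E = exp ((\<eta> - of_nat j) * of_real \<epsilon>)"
  define F where "F = gen_ffact \<alpha> (\<gamma> - 1) z"
  have "gen_stirling_term \<alpha> \<beta> r \<gamma> \<eta> \<epsilon> j
      = (z - (\<gamma> - 1) * of_real \<alpha>) * gen_stirling_term \<alpha> \<beta> r (\<gamma> - 1) \<eta> \<epsilon> j"
  proof (cases "\<eta> gchoose j = 0")
    case False
    then have "gen_ffact_defined \<alpha> (\<gamma> - 1) z" if "\<gamma> = 0"
      using def that by (simp add: gen_stirling_defined_def z_def)
    from gen_ffact_recurrence[OF \<alpha> this] show ?thesis
      by (simp add: gen_stirling_term_def z_def)
  qed (simp add: gen_stirling_term_def)
  also have "\<dots> = (r + \<eta> * of_real \<beta> - (\<gamma> - 1) * of_real \<alpha>) *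
        gen_stirling_term \<alpha> \<beta> r (\<gamma> - 1) \<eta> \<epsilon> j
      - of_real \<beta> * (of_nat j * gen_stirling_term \<alpha> \<beta> r (\<gamma> - 1) \<eta> \<epsilon> j)"
    by (simp add: z_def algebra_simps)
  also have "of_nat j * gen_stirling_term \<alpha> \<beta> r (\<gamma> - 1) \<eta> \<epsilon> j
      = - \<eta> * (case j of 0 \<Rightarrow> 0 | Suc i \<Rightarrow> gen_stirling_term \<alpha> \<beta> r (\<gamma> - 1) (\<eta> - 1) \<epsilon> i)"
  proof (cases j)
    case (Suc i)
    have shift: "\<eta> - 1 - of_nat i = \<eta> - of_nat j"
      by (simp add: Suc)
    have "of_nat j * gen_stirling_term \<alpha> \<beta> r (\<gamma> - 1) \<eta> \<epsilon> j
        = (-1) ^ j * (of_nat (Suc i) * (\<eta> gchoose Suc i)) * E * F"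
      by (simp add: gen_stirling_term_def z_def E_def F_def Suc mult_ac)
    also have "\<dots> = - \<eta> * ((-1) ^ i * ((\<eta> - 1) gchoose i) * E * F)"
      unfolding gbinomial_absorption by (simp add: Suc)
    also have "(-1) ^ i * ((\<eta> - 1) gchoose i) * E * F
        = gen_stirling_term \<alpha> \<beta> r (\<gamma> - 1) (\<eta> - 1) \<epsilon> i"
      by (simp only: gen_stirling_term_def shift z_def E_def F_def)
    finally show ?thesis
      by (simp add: Suc)
  qed simp
  finally show ?thesis
    by (simp add: mult_ac)
qed

text \<open>
  The common form of all parts of the theorem: the termwise recurrence, summed over \<open>j\<close>.
\<close>

lemma gen_stirling_recurrence:
  assumes \<alpha>: "\<alpha> > 0" and \<beta>: "\<beta> > 0"
    and def: "gen_stirling_defined \<alpha> \<beta> r \<gamma> \<eta> \<epsilon>"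
    and def1: "gen_stirling_defined \<alpha> \<beta> r (\<gamma> - 1) \<eta> \<epsilon>"
    and def2: "gen_stirling_defined \<alpha> \<beta> r (\<gamma> - 1) (\<eta> - 1) \<epsilon>"
  shows "gen_stirling \<alpha> \<beta> r \<gamma> \<eta> \<epsilon> =
           (r + \<eta> * of_real \<beta> - (\<gamma> - 1) * of_real \<alpha>) * gen_stirling \<alpha> \<beta> r (\<gamma> - 1) \<eta> \<epsilon>
           + gen_stirling \<alpha> \<beta> r (\<gamma> - 1) (\<eta> - 1) \<epsilon>"
proof -
  define C where "C = r + \<eta> * of_real \<beta> - (\<gamma> - 1) * of_real \<alpha>"
  define P where "P = rGamma (\<eta> + 1) / complex_of_real \<beta> powr \<eta>"
  obtain s where s: "gen_stirling_term \<alpha> \<beta> r \<gamma> \<eta> \<epsilon> sums s"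
    and S: "gen_stirling \<alpha> \<beta> r \<gamma> \<eta> \<epsilon> = P * s"
    using gen_stirling_sums[OF def] unfolding P_def .
  obtain s1 where s1: "gen_stirling_term \<alpha> \<beta> r (\<gamma> - 1) \<eta> \<epsilon> sums s1"
    and S1: "gen_stirling \<alpha> \<beta> r (\<gamma> - 1) \<eta> \<epsilon> = P * s1"
    using gen_stirling_sums[OF def1] unfolding P_def .
  obtain s2 where s2: "gen_stirling_term \<alpha> \<beta> r (\<gamma> - 1) (\<eta> - 1) \<epsilon> sums s2"
    and S2: "gen_stirling \<alpha> \<beta> r (\<gamma> - 1) (\<eta> - 1) \<epsilon>
      = rGamma (\<eta> - 1 + 1) / of_real \<beta> powr (\<eta> - 1) * s2"
    using gen_stirling_sums[OF def2] .
  have "(\<lambda>j. case j of 0 \<Rightarrow> 0 | Suc i \<Rightarrow> gen_stirling_term \<alpha> \<beta> r (\<gamma> - 1) (\<eta> - 1) \<epsilon> i) sums s2"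
    using s2 sums_Suc_iff[of "\<lambda>j. case j of 0 \<Rightarrow> 0
      | Suc i \<Rightarrow> gen_stirling_term \<alpha> \<beta> r (\<gamma> - 1) (\<eta> - 1) \<epsilon> i" s2] by simp
  then have "gen_stirling_term \<alpha> \<beta> r \<gamma> \<eta> \<epsilon> sums (C * s1 + \<eta> * of_real \<beta> * s2)"
    unfolding gen_stirling_term_recurrence[OF \<alpha> def1, abs_def] C_def
    by (intro sums_add sums_mult s1)
  with s have "s = C * s1 + \<eta> * of_real \<beta> * s2"
    by (rule sums_unique2)
  then have "P * s = C * (P * s1) + P * (\<eta> * of_real \<beta>) * s2"
    by (simp add: algebra_simps)
  moreover have "P * (\<eta> * of_real \<beta>) = rGamma (\<eta> - 1 + 1) / of_real \<beta> powr (\<eta> - 1)"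
    using \<beta> rGamma_plus1[of \<eta>] by (simp add: P_def powr_diff divide_simps mult.commute)
  ultimately show ?thesis
    by (simp only: S S1 S2 C_def)
qed

theorem theorem3p3:
  fixes \<alpha> \<beta> :: real and r :: complex
  assumes "\<alpha> > 0" and "\<beta> > 0"
  shows
    "(\<forall>(\<gamma>::complex) (\<eta>::complex) (\<epsilon>::real). \<eta> \<notin> \<int> \<longrightarrow> \<epsilon> > 0 \<longrightarrow>
        gen_stirling_defined \<alpha> \<beta> r \<gamma> \<eta> \<epsilon> \<longrightarrow>
        gen_stirling_defined \<alpha> \<beta> r (\<gamma> - 1) \<eta> \<epsilon> \<longrightarrow>
        gen_stirling_defined \<alpha> \<beta> r (\<gamma> - 1) (\<eta> - 1) \<epsilon> \<longrightarrow>
        gen_stirling \<alpha> \<beta> r \<gamma> \<eta> \<epsilon> =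
          (r + \<eta> * of_real \<beta> - (\<gamma> - 1) * of_real \<alpha>) * gen_stirling \<alpha> \<beta> r (\<gamma> - 1) \<eta> \<epsilon>
          + gen_stirling \<alpha> \<beta> r (\<gamma> - 1) (\<eta> - 1) \<epsilon>)
   \<and> (\<forall>(\<gamma>::complex) (\<eta>::complex). \<eta> \<notin> \<int> \<longrightarrow> Re \<eta> > Re \<gamma> \<longrightarrow>
        gen_stirling_defined \<alpha> \<beta> r \<gamma> \<eta> 0 \<longrightarrow>
        gen_stirling_defined \<alpha> \<beta> r (\<gamma> - 1) \<eta> 0 \<longrightarrow>
        gen_stirling_defined \<alpha> \<beta> r (\<gamma> - 1) (\<eta> - 1) 0 \<longrightarrow>
        gen_stirling \<alpha> \<beta> r \<gamma> \<eta> 0 =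
          (r + \<eta> * of_real \<beta> - (\<gamma> - 1) * of_real \<alpha>) * gen_stirling \<alpha> \<beta> r (\<gamma> - 1) \<eta> 0
          + gen_stirling \<alpha> \<beta> r (\<gamma> - 1) (\<eta> - 1) 0)
   \<and> (\<forall>(\<gamma>::complex) (k::nat) (\<epsilon>::real). k \<ge> 1 \<longrightarrow> \<epsilon> \<ge> 0 \<longrightarrow>
        gen_stirling_defined \<alpha> \<beta> r \<gamma> (of_nat k) \<epsilon> \<longrightarrow>
        gen_stirling_defined \<alpha> \<beta> r (\<gamma> - 1) (of_nat k) \<epsilon> \<longrightarrow>
        gen_stirling_defined \<alpha> \<beta> r (\<gamma> - 1) (of_nat (k - 1)) \<epsilon> \<longrightarrow>
        gen_stirling \<alpha> \<beta> r \<gamma> (of_nat k) \<epsilon> =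
          (r + of_nat k * of_real \<beta> - (\<gamma> - 1) * of_real \<alpha>) * gen_stirling \<alpha> \<beta> r (\<gamma> - 1) (of_nat k) \<epsilon>
          + gen_stirling \<alpha> \<beta> r (\<gamma> - 1) (of_nat (k - 1)) \<epsilon>)
   \<and> (\<forall>(\<gamma>::complex) (k::nat). k \<ge> 1 \<longrightarrow>
        gen_stirling_defined \<alpha> \<beta> r \<gamma> (of_nat k) 0 \<longrightarrow>
        gen_stirling_defined \<alpha> \<beta> r (\<gamma> - 1) (of_nat k) 0 \<longrightarrow>
        gen_stirling_defined \<alpha> \<beta> r (\<gamma> - 1) (of_nat (k - 1)) 0 \<longrightarrow>
        gen_stirling \<alpha> \<beta> r \<gamma> (of_nat k) 0 =
          (r + of_nat k * of_real \<beta> - (\<gamma> - 1) * of_real \<alpha>) * gen_stirling \<alpha> \<beta> r (\<gamma> - 1) (of_nat k) 0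
          + gen_stirling \<alpha> \<beta> r (\<gamma> - 1) (of_nat (k - 1)) 0)"
  using assms gen_stirling_recurrence by (simp add: of_nat_diff)

end
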